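(* Let $A>1$, let $C_0:Q\to\mathbb{R}_+$ be a fixed base cost function (satisfying C1–C5 in the context), and let $\mathcal{C}_{\text{over}}=\{a\,C_0 : a\in[1,A]\}$ be the family of overround cost functions, with metric $d_\infty(C,C'):=\sup_{q\in Q}|C(q)-C'(q)|$. Then there exists a bandit market maker, using the CAB algorithm (described in the context) to choose the cost functions $C^1,\ldots,C^T\in\mathcal{C}_{\text{over}}$ in the market making bandit game, that achieves regret $O(T^{2/3}\log^{1/3}T)$ against $d_\infty$-smooth trades.
   Context: **Cost functions.** $Q$ is a closed, bounded (convex) subset of $\mathbb{R}_+^n$, the set of possible market positions. A cost function is a continuous function $C:Q\to\mathbb{R}_+$; its prices are $\pi(q)=\nabla C(q)$ (so $C$ is taken to be continuously differentiable). The base cost function $C=C_0$ satisfies: - C1 (convexity): $C(\lambda q+(1-\lambda)q')\le\lambda C(q)+(1-\lambda)C(q')$ for all $q,q'\in Q$, $\lambda\in[0,1]$. - C2 (monotonicity): $C(q)\ge C(q')$ for all $q,q'\in Q$ with $q\ge q'$ componentwise. - C3 (bounded loss): $\sup_{q\in Q}\left(\max_i q_i-C(q)\right)<\infty$. - C4 (potentially profitable): $\sum_{i=1}^n\pi_i(q)\ge1$ for all $q\in Q$, and $\sum_{i=1}^n\pi_i(q)>1$ for some $q\in Q$. - C5 (bounded prices): there is $P<\infty$ with $\pi(q)\in[0,P]^n$ for all $q\in Q$. **Value and reward.** Let $\Delta^n$ be the probability simplex in $\mathbb{R}^n$. For a cost function $C$, $q\in Q$ and $p\in\Delta^n$, set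 $V_q(C,p)=C(q)-\langle q,p\rangle$. For $s\in\mathbb{R}_+^n$ with $q+s\in Q$, the reward for using $C$ in position $q$ with trades $s$ is $$r_q(C;s)=\min_{p\in\Delta^n}V_{q+s}(C,p)-\min_{p'\in\Delta^n}V_q(C,p').$$ **The market making bandit game.** There are $T$ rounds. In round $t$ the market is in position $q^t\in Q$, and the market maker chooses an arm $a^t\in[1,A]$, i.e. the cost function $C^t=a^tC_0$. An adversary, who may depend on the history of the market maker's previous choices, determines the trades of the round, which may also depend on the cost function in use: $s^t(C)\in\mathbb{R}_+^n$, with $q^t+s^t(C)\in Q$, denotes the aggregate trade occurring in round $t$ if $C$ is used. The reward function of round $t$ is $r^t(a)=r_{q^t}(aC_0;s^t(aC_0))$, $a\in[1,A]$; the market maker receives $r^t(a^t)$, and the rewards of the unplayed arms are not revealed. The next position is $q^{t+1}=q^t+s^t(C^t)$. **Regret.** The regret of the sequence of choices $a^1,\ldots,a^T$ is $\max_{a\in[1,A]}\sum_{t=1}^T r^t(a)-\sum_{t=1}^T r^t(a^t)$. **$d_\infty$-smooth trades.** There is a constant $K$ such that in every round the largest possible difference in the trades the market maker can face when choosing between $C$ and $C'$ is bounded by $K\,d_\infty(C,C')$: $\|s^t(C)-s^t(C')\|\le K\,d_\infty(C,C')$ for all $C,C'\in\mathcal{C}_{\text{over}}$, with $\|\cdot\|$ the Euclidean norm. **The CAB algorithm.** CAB is R. Kleinberg's algorithm for the continuum-armed bandit problem, known to have the following guarantee. Call $f:S\to\mathbb{R}$ uniformly locally Lipschitz with constant $L>0$,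 exponent $\alpha\in(0,1]$ and restriction $\delta>0$ if $|f(u)-f(u')|\le L|u-u'|^\alpha$ for all $u,u'\in S$ with $|u-u'|\le\delta$. If $S$ is a bounded subset of $\mathbb{R}$ and all reward functions $S\to[0,1]$ are uniformly locally Lipschitz with the same $\alpha,L,\delta$, then CAB achieves regret $O\big(T^{\frac{\alpha+1}{2\alpha+1}}\log^{\frac{\alpha}{2\alpha+1}}T\big)$ against adaptive adversaries. Here CAB is used with arm set $S=[1,A]$, arm $a$ standing for the cost function $aC_0$, and with the (bounded) rewards mapped to $[0,1]$. *)

theory Defs
  imports "HOL-Probability.Probability" "HOL-Library.Landau_Symbols"
begin

section \<open>Cost functions\<close>

text \<open>
  As \<^term>\<open>Q\<close> may have boundary points or empty interior, the gradient is taken within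
  \<^term>\<open>Q\<close>. It need not be unique then, so the price map \<^term>\<open>\<pi>\<close> is a parameter.
\<close>

definition is_price_map ::
  "(real ^ 'n) set \<Rightarrow> (real ^ 'n \<Rightarrow> real) \<Rightarrow> (real ^ 'n \<Rightarrow> real ^ 'n) \<Rightarrow> bool" where
  "is_price_map Q C \<pi> \<longleftrightarrow>
     continuous_on Q \<pi> \<and> (\<forall>q\<in>Q. (C has_derivative (\<lambda>h. \<pi> q \<bullet> h)) (at q within Q))"

text \<open>The order on \<^typ>\<open>real ^ 'n\<close> is componentwise.\<close>

definition base_cost_function ::
  "(real ^ 'n) set \<Rightarrow> (real ^ 'n \<Rightarrow> real) \<Rightarrow> (real ^ 'n \<Rightarrow> real ^ 'n) \<Rightarrow> bool" where
  "base_cost_function Q C \<pi> \<longleftrightarrow>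
     closed Q \<and> bounded Q \<and> convex Q \<and> (\<forall>q\<in>Q. 0 \<le> q) \<and>
     continuous_on Q C \<and> (\<forall>q\<in>Q. 0 \<le> C q) \<and> is_price_map Q C \<pi> \<and>
     convex_on Q C \<and>
     (\<forall>q\<in>Q. \<forall>q'\<in>Q. q' \<le> q \<longrightarrow> C q' \<le> C q) \<and>
     bdd_above ((\<lambda>q. Max (range (\<lambda>i. q $ i)) - C q) ` Q) \<and>
     (\<forall>q\<in>Q. (\<Sum>i\<in>UNIV. \<pi> q $ i) \<ge> 1) \<and> (\<exists>q\<in>Q. (\<Sum>i\<in>UNIV. \<pi> q $ i) > 1) \<and>
     (\<exists>P. \<forall>q\<in>Q. \<forall>i. \<pi> q $ i \<in> {0..P})"

definition scaled_cost :: "(real ^ 'n \<Rightarrow> real) \<Rightarrow> real \<Rightarrow> real ^ 'n \<Rightarrow> real" where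
  "scaled_cost C\<^sub>0 a = (\<lambda>q. a * C\<^sub>0 q)"

definition overround_costs :: "(real ^ 'n \<Rightarrow> real) \<Rightarrow> real \<Rightarrow> (real ^ 'n \<Rightarrow> real) set" where
  "overround_costs C\<^sub>0 A = scaled_cost C\<^sub>0 ` {1..A}"

definition d_infty :: "(real ^ 'n) set \<Rightarrow> (real ^ 'n \<Rightarrow> real) \<Rightarrow> (real ^ 'n \<Rightarrow> real) \<Rightarrow> real" where
  "d_infty Q C C' = (SUP q\<in>Q. \<bar>C q - C' q\<bar>)"

section \<open>Value and reward\<close>

definition prob_simplex :: "(real ^ 'n) set" where
  "prob_simplex = {p. (\<forall>i. 0 \<le> p $ i) \<and> (\<Sum>i\<in>UNIV. p $ i) = 1}"

definition mm_value :: "real ^ 'n \<Rightarrow> (real ^ 'n \<Rightarrow> real) \<Rightarrow> real ^ 'n \<Rightarrow> real" where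
  "mm_value q C p = C q - q \<bullet> p"

text \<open>The simplex is compact and the value is affine in the distribution: infima are minima.\<close>

definition mm_reward :: "real ^ 'n \<Rightarrow> (real ^ 'n \<Rightarrow> real) \<Rightarrow> real ^ 'n \<Rightarrow> real" where
  "mm_reward q C s =
     (INF p\<in>prob_simplex. mm_value (q + s) C p) - (INF p\<in>prob_simplex. mm_value q C p)"

section \<open>Bandit games with an adaptive adversary\<close>

text \<open>
  An environment maps the arms played so far (oldest first) to the reward function of the
  current round. An algorithm maps the arms played so far, each paired with the reward received
  for it, to a distribution on arms. Rounds are counted from 0.
\<close>

type_synonym environment = "real list \<Rightarrow> real \<Rightarrow> real"
type_synonym algorithm = "(real \<times> real) list \<Rightarrow> real pmf"

definition bandit_algorithm :: "real set \<Rightarrow> algorithm \<Rightarrow> bool" where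
  "bandit_algorithm S alg \<longleftrightarrow> (\<forall>obs. set_pmf (alg obs) \<subseteq> S)"

definition observations :: "environment \<Rightarrow> real list \<Rightarrow> (real \<times> real) list" where
  "observations E as = map (\<lambda>t. (as ! t, E (take t as) (as ! t))) [0..<length as]"

primrec play :: "algorithm \<Rightarrow> environment \<Rightarrow> nat \<Rightarrow> real list pmf" where
  "play alg E 0 = return_pmf []"
| "play alg E (Suc T) =
     bind_pmf (play alg E T) (\<lambda>as. map_pmf (\<lambda>a. as @ [a]) (alg (observations E as)))"

text \<open>
  The adversary's past behaviour is not changed when an alternative fixed arm is evaluated:
  each round's reward function is the one determined by the arms actually played. On a compact
  arm set with continuous reward functions the supremum is a maximum.
\<close>

definition regret :: "real set \<Rightarrow> environment \<Rightarrow> real list \<Rightarrow> real" where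
  "regret S E as =
     (SUP a\<in>S. \<Sum>t<length as. E (take t as) a) - (\<Sum>t<length as. E (take t as) (as ! t))"

definition expected_regret :: "real set \<Rightarrow> algorithm \<Rightarrow> environment \<Rightarrow> nat \<Rightarrow> real" where
  "expected_regret S alg E T = measure_pmf.expectation (play alg E T) (regret S E)"

section \<open>The guarantee of the continuum-armed bandit algorithm\<close>

definition uniformly_locally_lipschitz ::
  "real set \<Rightarrow> real \<Rightarrow> real \<Rightarrow> real \<Rightarrow> (real \<Rightarrow> real) \<Rightarrow> bool" where
  "uniformly_locally_lipschitz S \<alpha> L \<delta> f \<longleftrightarrow>
     (\<forall>u\<in>S. \<forall>u'\<in>S. \<bar>u - u'\<bar> \<le> \<delta> \<longrightarrow> \<bar>f u - f u'\<bar> \<le> L * \<bar>u - u'\<bar> powr \<alpha>)"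

text \<open>
  The algorithm is given the arm set and the exponent, but neither the Lipschitz constant, nor the
  restriction, nor the number of rounds. The bound is uniform in the adversary.
\<close>

definition cab_guarantee :: "(real set \<Rightarrow> real \<Rightarrow> algorithm) \<Rightarrow> bool" where
  "cab_guarantee cab \<longleftrightarrow>
     (\<forall>S \<alpha>. S \<noteq> {} \<longrightarrow> bounded S \<longrightarrow> \<alpha> \<in> {0<..1} \<longrightarrow>
        bandit_algorithm S (cab S \<alpha>) \<and>
        (\<forall>L>0. \<forall>\<delta>>0.
           \<exists>B \<in> O(\<lambda>T::nat. real T powr ((\<alpha> + 1) / (2 * \<alpha> + 1)) * ln (real T) powr (\<alpha> / (2 * \<alpha> + 1))).
             \<forall>E. (\<forall>as. set as \<subseteq> S \<longrightarrow>
                    E as ` S \<subseteq> {0..1} \<and> uniformly_locally_lipschitz S \<alpha> L \<delta> (E as)) \<longrightarrow>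
                  (\<forall>T. expected_regret S (cab S \<alpha>) E T \<le> B T)))"

section \<open>The market making bandit game\<close>

text \<open>
  A trading strategy maps the arms played so far and the cost function in use to the trades of
  the current round; \<^term>\<open>q\<^sub>1\<close> is the initial position.
\<close>

type_synonym 'n trading = "real list \<Rightarrow> (real ^ 'n \<Rightarrow> real) \<Rightarrow> real ^ 'n"

primrec position ::
  "(real ^ 'n \<Rightarrow> real) \<Rightarrow> real ^ 'n \<Rightarrow> 'n trading \<Rightarrow> real list \<Rightarrow> nat \<Rightarrow> real ^ 'n" where
  "position C\<^sub>0 q\<^sub>1 s as 0 = q\<^sub>1"
| "position C\<^sub>0 q\<^sub>1 s as (Suc t) =
     position C\<^sub>0 q\<^sub>1 s as t + s (take t as) (scaled_cost C\<^sub>0 (as ! t))"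

definition market_environment ::
  "(real ^ 'n \<Rightarrow> real) \<Rightarrow> real ^ 'n \<Rightarrow> 'n trading \<Rightarrow> environment" where
  "market_environment C\<^sub>0 q\<^sub>1 s as a =
     mm_reward (position C\<^sub>0 q\<^sub>1 s as (length as)) (scaled_cost C\<^sub>0 a) (s as (scaled_cost C\<^sub>0 a))"

definition feasible_trades ::
  "(real ^ 'n) set \<Rightarrow> (real ^ 'n \<Rightarrow> real) \<Rightarrow> real \<Rightarrow> real ^ 'n \<Rightarrow> 'n trading \<Rightarrow> bool" where
  "feasible_trades Q C\<^sub>0 A q\<^sub>1 s \<longleftrightarrow>
     q\<^sub>1 \<in> Q \<and>
     (\<forall>as. set as \<subseteq> {1..A} \<longrightarrow> (\<forall>C\<in>overround_costs C\<^sub>0 A.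
        0 \<le> s as C \<and> position C\<^sub>0 q\<^sub>1 s as (length as) + s as C \<in> Q))"

definition smooth_trades ::
  "(real ^ 'n) set \<Rightarrow> (real ^ 'n \<Rightarrow> real) \<Rightarrow> real \<Rightarrow> real \<Rightarrow> 'n trading \<Rightarrow> bool" where
  "smooth_trades Q C\<^sub>0 A K s \<longleftrightarrow>
     (\<forall>as. set as \<subseteq> {1..A} \<longrightarrow> (\<forall>C\<in>overround_costs C\<^sub>0 A. \<forall>C'\<in>overround_costs C\<^sub>0 A.
        norm (s as C - s as C') \<le> K * d_infty Q C C'))"

text \<open>
  The market maker runs the algorithm with exponent 1 on the arms \<^term>\<open>{1..A}\<close>, feeding it
  rewards rescaled by an affine map that takes every reward possible in the game into the unit
  interval.
\<close>

definition uses_cab ::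
  "(real set \<Rightarrow> real \<Rightarrow> algorithm) \<Rightarrow> (real ^ 'n) set \<Rightarrow> (real ^ 'n \<Rightarrow> real) \<Rightarrow> real \<Rightarrow>
   algorithm \<Rightarrow> bool" where
  "uses_cab cab Q C\<^sub>0 A M \<longleftrightarrow>
     (\<exists>lo hi. lo < hi \<and>
        (\<forall>C\<in>overround_costs C\<^sub>0 A. \<forall>q\<in>Q. \<forall>s. 0 \<le> s \<longrightarrow> q + s \<in> Q \<longrightarrow> mm_reward q C s \<in> {lo..hi}) \<and>
        (\<forall>obs. M obs = cab {1..A} 1 (map (\<lambda>(a, r). (a, (r - lo) / (hi - lo))) obs)))"

end

theory Submission imports Defs
begin

text \<open>
  The minimal value \<open>min\<^sub>p V\<^sub>q(C, p)\<close> changes by at most \<open>\<bar>C q - C' q'\<bar> + \<parallel>q - q'\<parallel>\<close>, since every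
  \<open>p\<close> in the simplex has norm at most 1. As \<open>C\<^sub>0\<close> is bounded and Lipschitz on \<open>Q\<close> (by its bounded
  gradient and the convexity of \<open>Q\<close>), smoothness of the trades makes all round rewards Lipschitz
  in the arm with a common constant. An affine rescaling then turns the game into an instance of
  the CAB guarantee with exponent 1; the play is unchanged and the regret is only multiplied by a
  constant.
\<close>

section \<open>Rewards\<close>

text \<open>Turns estimates that are uniform in \<open>p\<close> into estimates of minimal values.
  Both families are required to be bounded below because a real infimum is unspecified
  otherwise.\<close>

lemma abs_INF_diff_le:
  fixes f g :: "'a \<Rightarrow> real"
  assumes "S \<noteq> {}" "bdd_below (f ` S)" "bdd_below (g ` S)"
    and le: "\<And>x. x \<in> S \<Longrightarrow> \<bar>f x - g x\<bar> \<le> d"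
  shows "\<bar>(INF x\<in>S. f x) - (INF x\<in>S. g x)\<bar> \<le> d"
proof -
  have "(INF x\<in>S. f x) - d \<le> g x" if "x \<in> S" for x
    using cINF_lower[OF assms(2) that] le[OF that] by linarith
  hence "(INF x\<in>S. f x) - d \<le> (INF x\<in>S. g x)"
    by (intro cINF_greatest assms(1))
  moreover have "(INF x\<in>S. g x) - d \<le> f x" if "x \<in> S" for x
    using cINF_lower[OF assms(3) that] le[OF that] by linarith
  hence "(INF x\<in>S. g x) - d \<le> (INF x\<in>S. f x)"
    by (intro cINF_greatest assms(1))
  ultimately show ?thesis
    by linarith
qed

lemma prob_simplex_nonempty: "(prob_simplex :: (real ^ 'n) set) \<noteq> {}"
proof -
  \<comment> \<open>Any vertex of the simplex will do; \<open>undefined\<close> stands for an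
    arbitrary coordinate.\<close>
  have "axis undefined 1 \<in> (prob_simplex :: (real ^ 'n) set)"
    by (simp add: prob_simplex_def axis_def)
  thus ?thesis by blast
qed

lemma norm_prob_simplex_le_1:
  assumes "p \<in> prob_simplex"
  shows "norm p \<le> 1"
  using norm_le_l1_cart[of p] assms by (simp add: prob_simplex_def)

lemma abs_inner_prob_simplex_le:
  assumes "p \<in> prob_simplex"
  shows "\<bar>x \<bullet> p\<bar> \<le> norm x"
  using Cauchy_Schwarz_ineq2[of x p]
    mult_left_mono[OF norm_prob_simplex_le_1[OF assms] norm_ge_zero[of x]]
  by linarith

lemma bdd_below_mm_value:
  fixes q :: "real ^ 'n"
  shows "bdd_below (mm_value q C ` prob_simplex)"
proof (rule bdd_belowI2)
  fix p :: "real ^ 'n" assume "p \<in> prob_simplex"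
  thus "C q - norm q \<le> mm_value q C p"
    using abs_inner_prob_simplex_le[of p q] by (simp add: mm_value_def)
qed

text \<open>Position and cost function vary at once: \<open>C' = C\<close> bounds a single reward,
  \<open>q' = q\<close> compares two arms before the trade, and the general case compares them after
  it.\<close>

lemma abs_min_mm_value_diff_le:
  fixes q q' :: "real ^ 'n"
  shows "\<bar>(INF p\<in>prob_simplex. mm_value q C p) - (INF p\<in>prob_simplex. mm_value q' C' p)\<bar>
     \<le> \<bar>C q - C' q'\<bar> + norm (q - q')"
proof (intro abs_INF_diff_le prob_simplex_nonempty bdd_below_mm_value)
  fix p :: "real ^ 'n" assume "p \<in> prob_simplex"
  thus "\<bar>mm_value q C p - mm_value q' C' p\<bar> \<le> \<bar>C q - C' q'\<bar> + norm (q - q')"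
    using abs_inner_prob_simplex_le[of p "q - q'"]
    by (simp add: mm_value_def inner_diff_left)
qed

lemma abs_mm_reward_le: "\<bar>mm_reward q C s\<bar> \<le> \<bar>C (q + s) - C q\<bar> + norm s"
  using abs_min_mm_value_diff_le[of "q + s" C q C] by (simp add: mm_reward_def)

lemma abs_mm_reward_diff_le:
  "\<bar>mm_reward q C s - mm_reward q C' s'\<bar>
     \<le> \<bar>C (q + s) - C' (q + s')\<bar> + norm (s - s') + \<bar>C q - C' q\<bar>"
  using abs_min_mm_value_diff_le[of "q + s" C "q + s'" C']
    abs_min_mm_value_diff_le[of q C q C']
  by (simp add: mm_reward_def)

section \<open>Regularity of the base cost on the compact set of positions\<close>

lemma base_cost_function_bounded:
  assumes "base_cost_function Q C\<^sub>0 \<pi>"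
  obtains M where "M > 0" "\<And>q. q \<in> Q \<Longrightarrow> \<bar>C\<^sub>0 q\<bar> \<le> M"
proof -
  have "compact Q" "continuous_on Q C\<^sub>0"
    using assms by (auto simp: base_cost_function_def compact_eq_bounded_closed)
  hence "bounded (C\<^sub>0 ` Q)"
    by (intro compact_imp_bounded compact_continuous_image)
  thus ?thesis
    using that by (auto simp: bounded_pos)
qed

text \<open>Mean value inequality on the convex set \<open>Q\<close>, for which derivatives within
  \<open>Q\<close> suffice. The constant bounds the Euclidean norm of the prices, a continuous image
  of a compact set.\<close>

lemma base_cost_function_lipschitz:
  assumes "base_cost_function Q C\<^sub>0 \<pi>"
  obtains G where "G > 0"
    "\<And>q q'. q \<in> Q \<Longrightarrow> q' \<in> Q \<Longrightarrow> \<bar>C\<^sub>0 q - C\<^sub>0 q'\<bar> \<le> G * norm (q - q')"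
proof -
  have "compact Q" "convex Q" "continuous_on Q \<pi>"
    and der: "\<And>q. q \<in> Q \<Longrightarrow> (C\<^sub>0 has_derivative (\<lambda>h. \<pi> q \<bullet> h)) (at q within Q)"
    using assms
    by (auto simp: base_cost_function_def compact_eq_bounded_closed is_price_map_def)
  hence "bounded (\<pi> ` Q)"
    by (intro compact_imp_bounded compact_continuous_image)
  then obtain G where G: "G > 0" "\<And>q. q \<in> Q \<Longrightarrow> norm (\<pi> q) \<le> G"
    by (auto simp: bounded_pos)
  have "\<bar>C\<^sub>0 q - C\<^sub>0 q'\<bar> \<le> G * norm (q - q')" if "q \<in> Q" "q' \<in> Q" for q q'
  proof -
    have "onorm (\<lambda>h. \<pi> x \<bullet> h) \<le> G" if "x \<in> Q" for x
    proof (rule onorm_bound)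
      fix h
      show "norm (\<pi> x \<bullet> h) \<le> G * norm h"
        using Cauchy_Schwarz_ineq2[of "\<pi> x" h]
          mult_right_mono[OF G(2)[OF that] norm_ge_zero[of h]]
        by simp
    qed (use G in simp)
    from differentiable_bound[OF \<open>convex Q\<close> der this that(2) that(1)] show ?thesis
      by (simp add: norm_minus_commute abs_minus_commute)
  qed
  with G(1) show ?thesis
    using that by blast
qed

section \<open>The environment of the market\<close>

lemma position_take:
  "t \<le> length as \<Longrightarrow> position C\<^sub>0 q\<^sub>1 s (as @ bs) t = position C\<^sub>0 q\<^sub>1 s as t"
  by (induction t) (auto simp: nth_append)

text \<open>Each later position is a position reached earlier plus a trade made there, and
  feasibility places exactly such sums in \<open>Q\<close>.\<close>

lemma position_in_Q:
  assumes "feasible_trades Q C\<^sub>0 A q\<^sub>1 s" "set as \<subseteq> {1..A}"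
  shows "position C\<^sub>0 q\<^sub>1 s as (length as) \<in> Q"
  using assms(2)
proof (induction as rule: rev_induct)
  case Nil
  thus ?case using assms(1) by (simp add: feasible_trades_def)
next
  case (snoc a as)
  hence "scaled_cost C\<^sub>0 a \<in> overround_costs C\<^sub>0 A" "set as \<subseteq> {1..A}"
    by (auto simp: overround_costs_def)
  with assms(1) show ?case
    by (simp add: feasible_trades_def position_take)
qed

lemma abs_scaled_cost_diff_le:
  assumes "\<bar>C\<^sub>0 q\<bar> \<le> M"
  shows "\<bar>scaled_cost C\<^sub>0 a q - scaled_cost C\<^sub>0 b q\<bar> \<le> M * \<bar>a - b\<bar>"
  using mult_right_mono[OF assms, of "\<bar>a - b\<bar>"]
  by (simp add: scaled_cost_def left_diff_distrib[symmetric] abs_mult mult.commute)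

lemma abs_d_infty_scaled_cost_le:
  assumes "Q \<noteq> {}" "\<And>q. q \<in> Q \<Longrightarrow> \<bar>C\<^sub>0 q\<bar> \<le> M"
  shows "\<bar>d_infty Q (scaled_cost C\<^sub>0 a) (scaled_cost C\<^sub>0 b)\<bar> \<le> M * \<bar>a - b\<bar>"
  unfolding d_infty_def
  using assms by (intro cSup_abs_le) (auto intro!: abs_scaled_cost_diff_le)

text \<open>Changing the arm at a fixed position costs \<open>M\<close> per unit both before and
  after the trade, whence \<open>2 * M\<close>. It also moves the position after the trade by at
  most \<open>\<bar>K\<bar> * M\<close> per unit; such a move counts \<open>A * G\<close> times
  through the cost and once through the inner product with \<open>p\<close>.\<close>

lemma market_environment_lipschitz:
  assumes M: "\<And>q. q \<in> Q \<Longrightarrow> \<bar>C\<^sub>0 q\<bar> \<le> M"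
    and G: "G > 0" "\<And>q q'. q \<in> Q \<Longrightarrow> q' \<in> Q \<Longrightarrow> \<bar>C\<^sub>0 q - C\<^sub>0 q'\<bar> \<le> G * norm (q - q')"
    and feasible: "feasible_trades Q C\<^sub>0 A q\<^sub>1 s"
    and smooth: "smooth_trades Q C\<^sub>0 A K s"
    and as: "set as \<subseteq> {1..A}" and a: "a \<in> {1..A}" and b: "b \<in> {1..A}"
  shows "\<bar>market_environment C\<^sub>0 q\<^sub>1 s as a - market_environment C\<^sub>0 q\<^sub>1 s as b\<bar>
    \<le> (2 * M + (A * G + 1) * (\<bar>K\<bar> * M)) * \<bar>a - b\<bar>"
proof -
  define q where "q = position C\<^sub>0 q\<^sub>1 s as (length as)"
  define u where "u = s as (scaled_cost C\<^sub>0 a)"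
  define v where "v = s as (scaled_cost C\<^sub>0 b)"
  have q: "q \<in> Q"
    using position_in_Q[OF feasible as] by (simp add: q_def)
  have costs: "scaled_cost C\<^sub>0 a \<in> overround_costs C\<^sub>0 A" "scaled_cost C\<^sub>0 b \<in> overround_costs C\<^sub>0 A"
    using a b by (auto simp: overround_costs_def)
  have qu: "q + u \<in> Q" and qv: "q + v \<in> Q"
    using feasible as costs by (auto simp: feasible_trades_def q_def u_def v_def)
  have "norm (u - v) \<le> K * d_infty Q (scaled_cost C\<^sub>0 a) (scaled_cost C\<^sub>0 b)"
    using smooth as costs by (auto simp: smooth_trades_def u_def v_def)
  \<comment> \<open>The sign of \<open>K\<close> is arbitrary, so absolute values are taken before
    the monotone estimate.\<close>
  also have "\<dots> \<le> \<bar>K\<bar> * \<bar>d_infty Q (scaled_cost C\<^sub>0 a) (scaled_cost C\<^sub>0 b)\<bar>"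
    by (metis abs_ge_self abs_mult)
  also have "\<dots> \<le> \<bar>K\<bar> * (M * \<bar>a - b\<bar>)"
    using q M by (intro mult_left_mono abs_d_infty_scaled_cost_le) auto
  finally have uv: "norm (u - v) \<le> \<bar>K\<bar> * M * \<bar>a - b\<bar>"
    by (simp add: mult.assoc)
  \<comment> \<open>The intermediate value \<open>b * C\<^sub>0 (q + u)\<close> separates the change
    of position, treated here, from the change of arm.\<close>
  have "\<bar>b * C\<^sub>0 (q + u) - b * C\<^sub>0 (q + v)\<bar> = b * \<bar>C\<^sub>0 (q + u) - C\<^sub>0 (q + v)\<bar>"
    using b by (simp add: right_diff_distrib[symmetric] abs_mult)
  also have "\<dots> \<le> A * (G * norm (u - v))"
    using G(2)[OF qu qv] a b by (intro mult_mono) auto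
  finally have "\<bar>scaled_cost C\<^sub>0 a (q + u) - scaled_cost C\<^sub>0 b (q + v)\<bar>
      \<le> M * \<bar>a - b\<bar> + A * G * norm (u - v)"
    using abs_scaled_cost_diff_le[of C\<^sub>0, OF M[OF qu], of a b]
    by (simp add: scaled_cost_def mult.assoc)
  hence "\<bar>mm_reward q (scaled_cost C\<^sub>0 a) u - mm_reward q (scaled_cost C\<^sub>0 b) v\<bar>
      \<le> 2 * M * \<bar>a - b\<bar> + (A * G + 1) * norm (u - v)"
    using abs_mm_reward_diff_le[of q "scaled_cost C\<^sub>0 a" u "scaled_cost C\<^sub>0 b" v]
      abs_scaled_cost_diff_le[of C\<^sub>0, OF M[OF q], of a b]
    by (simp add: algebra_simps)
  also have "(A * G + 1) * norm (u - v) \<le> (A * G + 1) * (\<bar>K\<bar> * M * \<bar>a - b\<bar>)"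
    using uv G(1) a by (intro mult_left_mono) auto
  finally show ?thesis
    by (simp add: market_environment_def q_def u_def v_def algebra_simps)
qed

lemma mm_reward_bounded:
  assumes M: "\<And>q. q \<in> Q \<Longrightarrow> \<bar>C\<^sub>0 q\<bar> \<le> M" and R: "\<And>q. q \<in> Q \<Longrightarrow> norm q \<le> R"
    and "C \<in> overround_costs C\<^sub>0 A" "q \<in> Q" "q + s \<in> Q"
  shows "\<bar>mm_reward q C s\<bar> \<le> 2 * (A * M) + 2 * R"
proof -
  obtain a where a: "a \<in> {1..A}" "C = scaled_cost C\<^sub>0 a"
    using assms(3) by (auto simp: overround_costs_def)
  have C: "\<bar>C x\<bar> \<le> A * M" if "x \<in> Q" for x
    using mult_mono[of a A "\<bar>C\<^sub>0 x\<bar>" M] M[OF that] a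
    by (simp add: scaled_cost_def abs_mult)
  \<comment> \<open>The trade is the difference of two positions in \<open>Q\<close>, so its norm is
    at most \<open>2 * R\<close>.\<close>
  have "norm s \<le> norm (q + s) + norm q"
    using norm_triangle_ineq4[of "q + s" q] by simp
  thus ?thesis
    using abs_mm_reward_le[of q C s] C[OF assms(4)] C[OF assms(5)] R[OF assms(4)] R[OF assms(5)]
    by linarith
qed

section \<open>Rescaling of rewards\<close>

lemma SUP_affine:
  fixes f :: "'a \<Rightarrow> real"
  assumes "S \<noteq> {}" "bdd_above (f ` S)" "c \<ge> 0"
  shows "(SUP x\<in>S. c * f x + d) = c * (SUP x\<in>S. f x) + d"
proof -
  have "mono (\<lambda>y. c * y + d)"
    using assms(3) by (intro monoI) (simp add: mult_left_mono)
  moreover have "continuous (at_left (Sup (f ` S))) (\<lambda>y. c * y + d)"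
    by (intro continuous_intros)
  ultimately show ?thesis
    using continuous_at_Sup_mono[of "\<lambda>y. c * y + d" "f ` S"] assms(1,2)
    by (simp add: image_image)
qed

lemma observations_rescale:
  assumes "\<And>as a. E' as a = f (E as a)"
  shows "observations E' as = map (\<lambda>(a, r). (a, f r)) (observations E as)"
  by (simp add: observations_def assms)

text \<open>The environment influences the play only through the observations given to the
  algorithm. Hence rescaling the rewards inside the algorithm or inside the environment gives the
  same play.\<close>

lemma play_cong:
  assumes "\<And>as. alg (observations E as) = alg' (observations E' as)"
  shows "play alg E T = play alg' E' T"
  by (induction T) (simp_all add: assms)

lemma set_pmf_play_subset:
  assumes "bandit_algorithm S alg" "as \<in> set_pmf (play alg E T)"
  shows "set as \<subseteq> S"
  using assms(2)
proof (induction T arbitrary: as)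
  case (Suc T)
  thus ?case using assms(1) by (fastforce simp: bandit_algorithm_def)
qed simp

text \<open>The shift adds \<open>length as * d\<close> to both terms of the regret and cancels. The
  unit interval bound keeps the sums bounded above, so that the supremum commutes with the affine
  map.\<close>

lemma regret_affine:
  assumes S: "S \<noteq> {}" "set as \<subseteq> S" and "c \<ge> 0"
    and bound: "\<And>as. set as \<subseteq> S \<Longrightarrow> E' as ` S \<subseteq> {0..1}"
    and E: "\<And>as a. E as a = c * E' as a + d"
  shows "regret S E as = c * regret S E' as"
proof -
  have "bdd_above ((\<lambda>a. \<Sum>t<length as. E' (take t as) a) ` S)"
  proof (rule bdd_aboveI2)
    fix a assume "a \<in> S"
    hence "E' (take t as) a \<le> 1" for t
      using bound[of "take t as"] S(2) set_take_subset[of t as] by (auto simp: image_subset_iff)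
    thus "(\<Sum>t<length as. E' (take t as) a) \<le> (\<Sum>t<length as. 1)"
      by (intro sum_mono)
  qed
  from SUP_affine[OF S(1) this \<open>c \<ge> 0\<close>, of "real (length as) * d"] show ?thesis
    by (simp add: regret_def E sum.distrib sum_distrib_left[symmetric] algebra_simps)
qed

lemma expected_regret_rescale:
  assumes alg: "bandit_algorithm S alg" and "S \<noteq> {}" "lo < hi"
    and bound: "\<And>as. set as \<subseteq> S \<Longrightarrow> (\<lambda>a. (E as a - lo) / (hi - lo)) ` S \<subseteq> {0..1}"
  shows "expected_regret S (\<lambda>obs. alg (map (\<lambda>(a, r). (a, (r - lo) / (hi - lo))) obs)) E T
    = (hi - lo) * expected_regret S alg (\<lambda>as a. (E as a - lo) / (hi - lo)) T"
proof -
  define E' where "E' = (\<lambda>as a. (E as a - lo) / (hi - lo))"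
  have play: "play (\<lambda>obs. alg (map (\<lambda>(a, r). (a, (r - lo) / (hi - lo))) obs)) E T = play alg E' T"
    by (intro play_cong)
      (simp add: observations_rescale[where E = E and f = "\<lambda>r. (r - lo) / (hi - lo)"] E'_def)
  \<comment> \<open>The two regrets are compared only on the support of the play, where all arms lie
    in \<open>S\<close>.\<close>
  have "measure_pmf.expectation (play alg E' T) (regret S E)
      = measure_pmf.expectation (play alg E' T) (\<lambda>as. (hi - lo) * regret S E' as)"
  proof (intro integral_cong_AE AE_pmfI)
    fix as assume "as \<in> set_pmf (play alg E' T)"
    hence "set as \<subseteq> S"
      using set_pmf_play_subset[OF alg] by blast
    thus "regret S E as = (hi - lo) * regret S E' as"
      using assms by (intro regret_affine[where d = lo]) (auto simp: E'_def)
  qed auto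
  thus ?thesis
    by (simp add: expected_regret_def play E'_def)
qed

section \<open>The regret bound for the rescaled algorithm\<close>

theorem theorem3:
  fixes Q :: "(real ^ 'n) set" and C\<^sub>0 :: "real ^ 'n \<Rightarrow> real" and \<pi> :: "real ^ 'n \<Rightarrow> real ^ 'n"
    and A :: real and cab :: "real set \<Rightarrow> real \<Rightarrow> algorithm"
  assumes "A > 1"
    and "base_cost_function Q C\<^sub>0 \<pi>"
    and "cab_guarantee cab"
  shows "\<exists>M. bandit_algorithm {1..A} M \<and> uses_cab cab Q C\<^sub>0 A M \<and>
    (\<forall>K. \<exists>B \<in> O(\<lambda>T::nat. real T powr (2 / 3) * ln (real T) powr (1 / 3)).
       \<forall>q\<^sub>1 s. feasible_trades Q C\<^sub>0 A q\<^sub>1 s \<longrightarrow> smooth_trades Q C\<^sub>0 A K s \<longrightarrow>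
         (\<forall>T. expected_regret {1..A} M (market_environment C\<^sub>0 q\<^sub>1 s) T \<le> B T))"
proof -
  define S where "S = {1..A}"
  have S: "S \<noteq> {}" "bounded S"
    using assms(1) by (auto simp: S_def)
  \<comment> \<open>For \<alpha> = 1 the exponents (\<alpha> + 1) / (2\<alpha> + 1) and \<alpha> /
    (2\<alpha> + 1) become 2/3 and 1/3.\<close>
  have alg: "bandit_algorithm S (cab S 1)"
    and guarantee: "\<And>L \<delta>. L > 0 \<Longrightarrow> \<delta> > 0 \<Longrightarrow>
      \<exists>B \<in> O(\<lambda>T::nat. real T powr (2 / 3) * ln (real T) powr (1 / 3)).
        \<forall>E. (\<forall>as. set as \<subseteq> S \<longrightarrow>
              E as ` S \<subseteq> {0..1} \<and> uniformly_locally_lipschitz S 1 L \<delta> (E as)) \<longrightarrow>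
            (\<forall>T. expected_regret S (cab S 1) E T \<le> B T)"
    using assms(3)[unfolded cab_guarantee_def, rule_format, OF S, of 1] by simp_all
  obtain M where M: "M > 0" "\<And>q. q \<in> Q \<Longrightarrow> \<bar>C\<^sub>0 q\<bar> \<le> M"
    using base_cost_function_bounded[OF assms(2)] by blast
  obtain G where G: "G > 0"
    "\<And>q q'. q \<in> Q \<Longrightarrow> q' \<in> Q \<Longrightarrow> \<bar>C\<^sub>0 q - C\<^sub>0 q'\<bar> \<le> G * norm (q - q')"
    using base_cost_function_lipschitz[OF assms(2)] by blast
  obtain R where R: "R > 0" "\<And>q. q \<in> Q \<Longrightarrow> norm q \<le> R"
    using assms(2) by (auto simp: base_cost_function_def bounded_pos)
  define hi where "hi = 2 * (A * M) + 2 * R"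
  define lo where "lo = - hi"
  have lohi: "lo < hi"
    using assms(1) M R by (simp add: lo_def hi_def add_pos_pos)
  have rewards: "mm_reward q C s \<in> {lo..hi}"
    if "C \<in> overround_costs C\<^sub>0 A" "q \<in> Q" "q + s \<in> Q" for q C s
    using mm_reward_bounded[of Q C\<^sub>0 M R, OF M(2) R(2) that] by (auto simp: lo_def hi_def)
  \<comment> \<open>The market maker is fixed before \<open>K\<close>: \<open>lo\<close> and
    \<open>hi\<close> come from bounds on \<open>Q\<close> and \<open>C\<^sub>0\<close> together
    with \<open>A\<close>. The constant \<open>K\<close> enters only the analysis, through the
    Lipschitz constant, which the algorithm is not told.\<close>
  define MM where "MM = (\<lambda>obs. cab S 1 (map (\<lambda>(a, r). (a, (r - lo) / (hi - lo))) obs))"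
  have "bandit_algorithm {1..A} MM"
    using alg by (auto simp: bandit_algorithm_def MM_def S_def)
  moreover have "uses_cab cab Q C\<^sub>0 A MM"
    unfolding uses_cab_def MM_def S_def using lohi rewards by blast
  moreover have "\<exists>B \<in> O(\<lambda>T::nat. real T powr (2 / 3) * ln (real T) powr (1 / 3)).
       \<forall>q\<^sub>1 s. feasible_trades Q C\<^sub>0 A q\<^sub>1 s \<longrightarrow> smooth_trades Q C\<^sub>0 A K s \<longrightarrow>
         (\<forall>T. expected_regret {1..A} MM (market_environment C\<^sub>0 q\<^sub>1 s) T \<le> B T)" for K
  proof -
    define L where "L = (2 * M + (A * G + 1) * (\<bar>K\<bar> * M)) / (hi - lo)"
    have "L > 0"
      using M G lohi assms(1) by (simp add: L_def add_pos_nonneg)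
    \<comment> \<open>The Lipschitz estimate holds for all pairs of arms, so the restriction
      \<delta> may be any positive number; 1 is chosen.\<close>
    from guarantee[OF this zero_less_one] obtain B
      where B: "B \<in> O(\<lambda>T::nat. real T powr (2 / 3) * ln (real T) powr (1 / 3))"
        "\<And>E T. (\<And>as. set as \<subseteq> S \<Longrightarrow>
           E as ` S \<subseteq> {0..1} \<and> uniformly_locally_lipschitz S 1 L 1 (E as)) \<Longrightarrow>
         expected_regret S (cab S 1) E T \<le> B T"
      by blast
    \<comment> \<open>The factor \<open>hi - lo\<close> converts regret back to the original units;
      it does not depend on \<open>T\<close>, so the asymptotic order is kept.\<close>
    have "expected_regret {1..A} MM (market_environment C\<^sub>0 q\<^sub>1 s) T \<le> (hi - lo) * B T"
      if feasible: "feasible_trades Q C\<^sub>0 A q\<^sub>1 s" and smooth: "smooth_trades Q C\<^sub>0 A K s"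
      for q\<^sub>1 s T
    proof -
      define E where "E = market_environment C\<^sub>0 q\<^sub>1 s"
      define E' where "E' = (\<lambda>as a. (E as a - lo) / (hi - lo))"
      have unit: "E' as ` S \<subseteq> {0..1}" if as: "set as \<subseteq> S" for as
      proof (intro image_subsetI)
        fix a assume "a \<in> S"
        hence cost: "scaled_cost C\<^sub>0 a \<in> overround_costs C\<^sub>0 A"
          by (auto simp: overround_costs_def S_def)
        have "E as a \<in> {lo..hi}"
          unfolding E_def market_environment_def
          using feasible as cost position_in_Q[OF feasible]
          by (intro rewards) (auto simp: feasible_trades_def S_def)
        thus "E' as a \<in> {0..1}"
          using lohi by (simp add: E'_def)
      qed
      have "uniformly_locally_lipschitz S 1 L 1 (E' as)" if as: "set as \<subseteq> S" for as
        unfolding uniformly_locally_lipschitz_def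
      proof (intro ballI impI)
        fix a b assume "a \<in> S" "b \<in> S"
        hence "\<bar>E as a - E as b\<bar> \<le> (2 * M + (A * G + 1) * (\<bar>K\<bar> * M)) * \<bar>a - b\<bar>"
          using market_environment_lipschitz[OF M(2) G feasible smooth] as
          by (simp add: E_def S_def)
        moreover have "E' as a - E' as b = (E as a - E as b) / (hi - lo)"
          by (simp add: E'_def diff_divide_distrib)
        ultimately show "\<bar>E' as a - E' as b\<bar> \<le> L * \<bar>a - b\<bar> powr 1"
          using lohi by (simp add: L_def abs_divide divide_right_mono)
      qed
      with unit have "expected_regret S (cab S 1) E' T \<le> B T"
        by (intro B(2)) blast
      moreover have "expected_regret S MM E T = (hi - lo) * expected_regret S (cab S 1) E' T"
        unfolding MM_def E'_def
        using unit by (intro expected_regret_rescale alg S(1) lohi) (auto simp: E'_def)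
      ultimately show ?thesis
        using lohi by (simp add: E_def S_def)
    qed
    moreover have "(\<lambda>T. (hi - lo) * B T) \<in> O(\<lambda>T. real T powr (2 / 3) * ln (real T) powr (1 / 3))"
      using B(1) by simp
    ultimately show ?thesis
      by (intro bexI[of _ "\<lambda>T. (hi - lo) * B T"]) simp_all
  qed
  ultimately show ?thesis
    by blast
qed

end
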